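(* Let $d(n) = r_{4,0}(n) - r_{4,2}(n)$ for integers $n \geq 0$, where $r_{m,i}(n)$ denotes the number of Fibonacci partitions of $n$ whose number of parts is congruent to $i$ modulo $m$. Then for every integer $k \geq 0$: (1) $d(n) = -16^k$ for $n = [(100)^{8k+1}1]_F$; and (2) $d(n) = 4 \cdot 16^k$ for $n = [(100)^{8k+5}1]_F$.
   Context: The Fibonacci numbers are $F_0 = 0$, $F_1 = 1$, and $F_n = F_{n-1} + F_{n-2}$ for $n \geq 2$. A Fibonacci partition of a natural number $n \ge 0$ is a way of writing $n$ as a sum of distinct Fibonacci numbers $F_j$ with $j \geq 2$, where order does not matter; equivalently, it is a finite set $S \subseteq \{2,3,4,\ldots\}$ with $\sum_{j \in S} F_j = n$. Its number of parts is $|S|$. For integers $m \geq 1$ and $i$, $r_{m,i}(n)$ is the number of Fibonacci partitions of $n$ having number of parts congruent to $i \pmod m$. For a binary string $x = b_1 b_2 \cdots b_t$ with $b_i \in \{0,1\}$, define $[x]_F := \sum_{1 \leq i \leq t} b_i F_{t-i+2}$ (most significant digit first). For a string $u$ and an integer $e \ge 0$, $u^e$ denotes the concatenation of $e$ copies of $u$; thus $(100)^{e}1$ is the binary string consisting of $e$ copies of the block $100$ followed by a single $1$. For example, $[(100)^1 1]_F = [1001]_F = F_5 + F_2 = 6$. *)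

theory Defs
  imports "HOL-Number_Theory.Fib" "HOL-Number_Theory.Cong"
begin

definition fib_partitions :: "nat \<Rightarrow> nat set set" where
  "fib_partitions n = {S. finite S \<and> S \<subseteq> {2..} \<and> (\<Sum>j\<in>S. fib j) = n}"

lemma le_Suc_fib: "n \<le> Suc (fib n)"
proof (induction n rule: fib.induct)
  case (3 n)
  show ?case
  proof (cases n)
    case (Suc m)
    then have "0 < fib n" by (simp add: fib_neq_0_nat)
    with 3 show ?thesis by simp
  qed simp
qed simp_all

text \<open>So the cardinality in the definition of \<open>r\<close> below is a genuine count.\<close>

lemma finite_fib_partitions: "finite (fib_partitions n)"
proof (rule finite_subset)
  show "fib_partitions n \<subseteq> Pow {..Suc n}"
  proof
    fix S assume "S \<in> fib_partitions n"
    then have fin: "finite S" and sum: "(\<Sum>j\<in>S. fib j) = n"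
      by (simp_all add: fib_partitions_def)
    have "j \<le> Suc n" if "j \<in> S" for j
    proof -
      have "fib j \<le> n" using member_le_sum[of j S fib] fin sum that by auto
      then show ?thesis using le_Suc_fib[of j] by linarith
    qed
    then show "S \<in> Pow {..Suc n}" by auto
  qed
qed simp

definition r :: "nat \<Rightarrow> int \<Rightarrow> nat \<Rightarrow> nat" where
  "r m i n = card {S \<in> fib_partitions n. [int (card S) = i] (mod int m)}"

definition d :: "nat \<Rightarrow> int" where
  "d n = int (r 4 0 n) - int (r 4 2 n)"

text \<open>Strings are lists, most significant digit first; the digit \<open>b\<^sub>i\<close> is \<open>x ! (i - 1)\<close>.\<close>

definition fib_value :: "nat list \<Rightarrow> nat" where
  "fib_value x = (\<Sum>i = 1..length x. x ! (i - 1) * fib (length x - i + 2))"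

definition string_power :: "'a list \<Rightarrow> nat \<Rightarrow> 'a list" where
  "string_power u e = concat (replicate e u)"

lemma "fib_value (string_power [1,0,0] 1 @ [1]) = 6"
  by (simp add: fib_value_def string_power_def numeral_eq_Suc)

end

theory Submission
  imports Defs Complex_Main
begin

text \<open>Let \<open>G(n) = \<Sum> \<i>\<^bsup>|S|\<^esup>\<close> over the Fibonacci partitions \<open>S\<close> of \<open>n\<close>, so that \<open>d(n) = Re G(n)\<close>.
  If \<open>F\<^sub>m \<le> n < F\<^bsub>m+1\<^esub>\<close>, then in a partition of \<open>n + F\<^bsub>m+3\<^esub>\<close> the summand \<open>F\<^bsub>m+3\<^esub>\<close> is
  either present or replaced by \<open>F\<^bsub>m+2\<^esub> + F\<^bsub>m+1\<^esub>\<close>, and what is left is an arbitrary partition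
  of \<open>n\<close>. Hence \<open>G(n + F\<^bsub>m+3\<^esub>) = (\<i> + \<i>\<^sup>2) G(n)\<close>, the value at \<open>[(100)\<^sup>e1]\<^sub>F\<close> is \<open>\<i>(\<i> - 1)\<^sup>e\<close>,
  and \<open>(\<i> - 1)\<^sup>4 = -4\<close>.\<close>

lemma sum_fib_from_2: "(\<Sum>j\<in>{2..<m + 2}. fib j) + 2 = fib (m + 3)"
  by (induction m) (simp_all add: numeral_eq_Suc)

lemma sum_fib_subset_less:
  assumes "S \<subseteq> {2..<m + 2}"
  shows "sum fib S < fib (m + 3)"
proof -
  have "sum fib S \<le> sum fib {2..<m + 2}"
    using assms by (intro sum_mono2) auto
  then show ?thesis using sum_fib_from_2[of m] by linarith
qed

lemma fib_partition_less:
  assumes "S \<in> fib_partitions n" "n < fib m" "j \<in> S"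
  shows "j < m"
proof (rule ccontr)
  assume "\<not> j < m"
  then have "fib m \<le> fib j" by (simp add: fib_mono)
  also have "fib j \<le> sum fib S"
    using assms by (intro member_le_sum) (auto simp: fib_partitions_def)
  finally show False using assms by (simp add: fib_partitions_def)
qed

lemma fib_partition_Un:
  assumes "S \<in> fib_partitions n" "finite T" "T \<subseteq> {2..}" "S \<inter> T = {}"
  shows "S \<union> T \<in> fib_partitions (n + sum fib T)"
  using assms by (auto simp: fib_partitions_def sum.union_disjoint)

lemma fib_partition_Diff:
  assumes "S \<in> fib_partitions (n + sum fib T)" "T \<subseteq> S"
  shows "S - T \<in> fib_partitions n"
proof -
  have "finite T" using assms by (auto simp: fib_partitions_def intro: finite_subset)
  then show ?thesis
    using assms by (auto simp: fib_partitions_def sum_diff_nat)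
qed

lemma fib_partitions_add_fib:
  assumes "1 \<le> m" "fib m \<le> n" "n < fib (m + 1)"
  shows "fib_partitions (n + fib (m + 3)) =
    (\<lambda>S. S \<union> {m + 3}) ` fib_partitions n \<union> (\<lambda>S. S \<union> {m + 1, m + 2}) ` fib_partitions n"
    (is "?L = ?A \<union> ?B")
proof (intro equalityI subsetI)
  have fib3: "fib (m + 3) = sum fib {m + 1, m + 2}" "fib (m + 3) = sum fib {m + 3}"
    by (simp_all add: numeral_eq_Suc)
  {
    fix S assume S: "S \<in> ?L"
    \<comment> \<open>This expansion isolates \<open>fib (m + 1)\<close>, so
      \<open>n < fib (m + 1)\<close> rules out every index from \<open>m + 4\<close> on.\<close>
    have fib4: "fib (m + 4) = fib (m + 3) + (fib (m + 1) + fib m)"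
      using \<open>1 \<le> m\<close> by (cases m) (simp_all add: numeral_eq_Suc)
    then have "n + fib (m + 3) < fib (m + 4)" using assms by linarith
    then have lt: "j < m + 4" if "j \<in> S" for j
      using fib_partition_less[OF S] that by blast
    have sub: "S \<subseteq> {2..}" and sum: "sum fib S = n + fib (m + 3)" and fin: "finite S"
      using S by (auto simp: fib_partitions_def)
    show "S \<in> ?A \<union> ?B"
    proof (cases "m + 3 \<in> S")
      case True
      then have "S - {m + 3} \<in> fib_partitions n"
        using fib_partition_Diff[of S n "{m + 3}"] S by simp
      moreover have "S = (S - {m + 3}) \<union> {m + 3}" using True by auto
      ultimately show ?thesis by blast
    next
      case False
      \<comment> \<open>Otherwise all indices lie below \<open>m + 2\<close>, and even using all of
        them yields less than \<open>fib (m + 3)\<close>.\<close>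
      have in2: "m + 2 \<in> S"
      proof (rule ccontr)
        assume "m + 2 \<notin> S"
        have "S \<subseteq> {2..<m + 2}"
        proof
          fix j assume "j \<in> S"
          then have "j \<noteq> m + 3" "j \<noteq> m + 2" "j < m + 4" "2 \<le> j"
            using lt sub False \<open>m + 2 \<notin> S\<close> by auto
          then show "j \<in> {2..<m + 2}" by auto
        qed
        then show False using sum_fib_subset_less[of S m] sum by linarith
      qed
      \<comment> \<open>Here the lower bound on \<open>n\<close> enters: without
        \<open>m + 1\<close> the total is below
        \<open>2 * fib (m + 2) = fib (m + 3) + fib m\<close>. Since \<open>1 \<le> m\<close>,
        \<open>(m - 1) + 2\<close> is the index \<open>m + 1\<close>.\<close>
      have in1: "m + 1 \<in> S"
      proof (rule ccontr)
        assume "m + 1 \<notin> S"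
        have "S - {m + 2} \<subseteq> {2..<(m - 1) + 2}"
        proof
          fix j assume "j \<in> S - {m + 2}"
          then have "j \<noteq> m + 3" "j \<noteq> m + 2" "j \<noteq> m + 1" "j < m + 4" "2 \<le> j"
            using lt sub False \<open>m + 1 \<notin> S\<close> by auto
          then show "j \<in> {2..<(m - 1) + 2}" by auto
        qed
        then have "sum fib (S - {m + 2}) < fib (m + 2)"
          using sum_fib_subset_less[of "S - {m + 2}" "m - 1"] \<open>1 \<le> m\<close>
          by (simp add: numeral_eq_Suc)
        moreover have "sum fib S = fib (m + 2) + sum fib (S - {m + 2})"
          using in2 fin by (simp add: sum.remove)
        moreover have "fib (m + 3) = fib (m + 2) + fib (m + 1)"
          "fib (m + 2) = fib (m + 1) + fib m"
          by (simp_all add: numeral_eq_Suc)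
        ultimately show False using sum \<open>fib m \<le> n\<close> by linarith
      qed
      have "S - {m + 1, m + 2} \<in> fib_partitions n"
        using fib_partition_Diff[of S n "{m + 1, m + 2}"] S in1 in2 fib3(1) by simp
      moreover have "S = (S - {m + 1, m + 2}) \<union> {m + 1, m + 2}" using in1 in2 by auto
      ultimately show ?thesis by blast
    qed
  next
    fix S' assume "S' \<in> ?A \<union> ?B"
    then obtain S T where S: "S \<in> fib_partitions n" and T: "T = {m + 3} \<or> T = {m + 1, m + 2}"
      and S': "S' = S \<union> T" by blast
    \<comment> \<open>Since \<open>n < fib (m + 1)\<close>, all indices in \<open>S\<close> are at
      most \<open>m\<close>, while those in \<open>T\<close> are larger.\<close>
    have "S \<inter> T = {}" using fib_partition_less[OF S assms(3)] T by fastforce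
    then have "S' \<in> fib_partitions (n + sum fib T)"
      using fib_partition_Un[OF S, of T] T \<open>1 \<le> m\<close> S' by auto
    then show "S' \<in> ?L" using T fib3 by metis
  }
qed

text \<open>The recursion uses no property of the imaginary unit, so the variable stays general
  until \<open>d\<close> is read off.\<close>

definition fib_partition_gf :: "'a::comm_semiring_1 \<Rightarrow> nat \<Rightarrow> 'a" where
  "fib_partition_gf x n = (\<Sum>S\<in>fib_partitions n. x ^ card S)"

lemma fib_partition_gf_add_fib:
  assumes "1 \<le> m" "fib m \<le> n" "n < fib (m + 1)"
  shows "fib_partition_gf x (n + fib (m + 3)) = (x + x\<^sup>2) * fib_partition_gf x n"
proof -
  let ?P = "fib_partitions n"
  have less: "j \<le> m" if "S \<in> ?P" "j \<in> S" for S j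
    using fib_partition_less[OF that(1) assms(3) that(2)] by simp
  have fin: "finite S" if "S \<in> ?P" for S
    using that by (simp add: fib_partitions_def)
  \<comment> \<open>One computation for both choices of \<open>T\<close>: adjoining indices above
    \<open>m\<close> is injective and adds \<open>card T\<close> parts.\<close>
  have gen: "(\<Sum>S'\<in>(\<lambda>S. S \<union> T) ` ?P. x ^ card S') = x ^ card T * fib_partition_gf x n"
    if T: "T \<subseteq> {m<..}" "finite T" for T
  proof -
    have disj: "S \<inter> T = {}" if "S \<in> ?P" for S
      using less[OF that] T by fastforce
    then have "inj_on (\<lambda>S. S \<union> T) ?P"
      by (intro inj_onI) blast
    then have "(\<Sum>S'\<in>(\<lambda>S. S \<union> T) ` ?P. x ^ card S') = (\<Sum>S\<in>?P. x ^ card (S \<union> T))"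
      by (simp add: sum.reindex)
    also have "\<dots> = (\<Sum>S\<in>?P. x ^ card T * x ^ card S)"
      using disj fin T by (intro sum.cong) (simp_all add: card_Un_disjoint power_add mult.commute)
    finally show ?thesis by (simp add: fib_partition_gf_def sum_distrib_left)
  qed
  \<comment> \<open>The index \<open>m + 3\<close> tells the two families apart, so nothing is
    counted twice.\<close>
  have "m + 3 \<notin> S \<union> {m + 1, m + 2}" if "S \<in> ?P" for S using less[OF that] by fastforce
  then have "(\<lambda>S. S \<union> {m + 3}) ` ?P \<inter> (\<lambda>S. S \<union> {m + 1, m + 2}) ` ?P = {}"
    by blast
  then have "fib_partition_gf x (n + fib (m + 3)) =
    (\<Sum>S\<in>(\<lambda>S. S \<union> {m + 3}) ` ?P. x ^ card S) + (\<Sum>S\<in>(\<lambda>S. S \<union> {m + 1, m + 2}) ` ?P. x ^ card S)"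
    unfolding fib_partition_gf_def fib_partitions_add_fib[OF assms]
    by (intro sum.union_disjoint) (simp_all add: finite_fib_partitions)
  also have "\<dots> = (x + x\<^sup>2) * fib_partition_gf x n"
    by (subst (1 2) gen) (auto simp: algebra_simps power2_eq_square)
  finally show ?thesis .
qed

lemma fib_value_Cons: "fib_value (b # x) = b * fib (length x + 2) + fib_value x"
proof -
  let ?f = "\<lambda>i. (b # x) ! (i - 1) * fib (length (b # x) - i + 2)"
  have "fib_value (b # x) = ?f 1 + sum ?f {Suc 1..Suc (length x)}"
    unfolding fib_value_def by (subst sum.atLeast_Suc_atMost) simp_all
  also have "sum ?f {Suc 1..Suc (length x)} = fib_value x"
    unfolding fib_value_def sum.shift_bounds_cl_Suc_ivl
    by (intro sum.cong) (auto simp: nth_Cons')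
  finally show ?thesis by simp
qed

lemma length_string_power: "length (string_power u e) = e * length u"
  by (simp add: string_power_def length_concat sum_list_replicate)

text \<open>A new block contributes only its leading 1. The index is left unsimplified to match
  \<open>m + 3\<close> with \<open>m = 3 * e + 2\<close>.\<close>

lemma fib_value_100_power_Suc:
  "fib_value (string_power [1,0,0] (Suc e) @ [1]) =
    fib_value (string_power [1,0,0] e @ [1]) + fib (3 * e + 2 + 3)"
proof -
  have "string_power [1,0,0] (Suc e) = 1 # 0 # 0 # string_power [1,0,0::nat] e"
    by (simp add: string_power_def)
  then show ?thesis
    by (simp add: fib_value_Cons length_string_power numeral_eq_Suc mult.commute)
qed

text \<open>These supply the hypotheses of \<open>fib_partition_gf_add_fib\<close> for
  \<open>m = 3 * e + 2\<close>.\<close>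

lemma fib_value_100_power_bounds:
  "fib (3 * e + 2) \<le> fib_value (string_power [1,0,0] e @ [1])"
  "fib_value (string_power [1,0,0] e @ [1]) < fib (3 * e + 2 + 1)"
proof (induction e)
  case 0
  show "fib (3 * 0 + 2) \<le> fib_value (string_power [1,0,0] 0 @ [1])"
    "fib_value (string_power [1,0,0] 0 @ [1]) < fib (3 * 0 + 2 + 1)"
    by (simp_all add: fib_value_def string_power_def numeral_eq_Suc)
next
  case (Suc e)
  have "fib (3 * e + 2 + 3 + 1) = fib (3 * e + 2 + 3) + (fib (3 * e + 2 + 1) + fib (3 * e + 2))"
    by (simp add: numeral_eq_Suc)
  moreover have idx: "3 * Suc e + 2 = 3 * e + 2 + 3" by simp
  ultimately show "fib_value (string_power [1,0,0] (Suc e) @ [1]) < fib (3 * Suc e + 2 + 1)"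
    using Suc unfolding fib_value_100_power_Suc idx by linarith
  show "fib (3 * Suc e + 2) \<le> fib_value (string_power [1,0,0] (Suc e) @ [1])"
    unfolding fib_value_100_power_Suc idx by simp
qed

lemma fib_partitions_1: "fib_partitions 1 = {{2}}"
proof (intro equalityI subsetI)
  fix S assume S: "S \<in> fib_partitions 1"
  then have "j = 2" if "j \<in> S" for j
    \<comment> \<open>As \<open>fib 3 = 2\<close> exceeds 1, every index is below 3.\<close>
    using fib_partition_less[OF S _ that, of 3] that
    by (force simp: fib_partitions_def numeral_eq_Suc)
  then have "S \<subseteq> {2}" by auto
  then show "S \<in> {{2}}" using S by (auto simp: fib_partitions_def subset_singleton_iff)
qed (auto simp: fib_partitions_def numeral_eq_Suc)

lemma fib_partition_gf_100_power:
  "fib_partition_gf x (fib_value (string_power [1,0,0] e @ [1])) = x * (x + x\<^sup>2) ^ e"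
proof (induction e)
  case 0
  have "fib_value (string_power [1,0,0] 0 @ [1]) = 1"
    by (simp add: fib_value_def string_power_def numeral_eq_Suc)
  then show ?case by (simp only: fib_partition_gf_def fib_partitions_1) simp
next
  case (Suc e)
  have "1 \<le> 3 * e + 2" by simp
  then show ?case
    unfolding fib_value_100_power_Suc
      fib_partition_gf_add_fib[OF \<open>1 \<le> 3 * e + 2\<close> fib_value_100_power_bounds] Suc
    by (simp add: mult.left_commute)
qed

text \<open>Powers of the imaginary unit have period 4, with real parts 1, 0, -1, 0; this turns the
  two residue counts in \<open>d\<close> into one real part.\<close>

lemma Re_imaginary_unit_power:
  "Re (\<i> ^ c) = of_bool ([int c = 0] (mod 4)) - of_bool ([int c = 2] (mod 4))"
proof -
  have "\<i> ^ c = \<i> ^ (4 * (c div 4) + c mod 4)" by simp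
  also have "\<dots> = \<i> ^ (c mod 4)"
    by (simp only: power_add power_mult) simp
  finally have *: "\<i> ^ c = \<i> ^ (c mod 4)" .
  have **: "int c mod 4 = int (c mod 4)" by (simp add: zmod_int)
  have "c mod 4 < 4" by simp
  then have "c mod 4 \<in> {0, 1, 2, 3}" by auto
  then show ?thesis unfolding * cong_def using **
    by (auto simp: power2_eq_square power3_eq_cube)
qed

lemma d_eq_Re_fib_partition_gf: "of_int (d n) = Re (fib_partition_gf \<i> n)"
proof -
  have r: "real (r 4 i n) = (\<Sum>S\<in>fib_partitions n. of_bool ([int (card S) = i] (mod 4)))" for i
    by (simp add: r_def finite_fib_partitions of_bool_def sum.If_cases Collect_conj_eq Int_commute
        cong: conj_cong)
  show ?thesis
    by (simp add: d_def r fib_partition_gf_def Re_imaginary_unit_power sum_subtractf)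
qed

theorem theorem3:
  fixes k :: nat
  shows "d (fib_value (string_power [1,0,0] (8 * k + 1) @ [1])) = - (16 ^ k) \<and>
         d (fib_value (string_power [1,0,0] (8 * k + 5) @ [1])) = 4 * 16 ^ k"
proof -
  have p4: "(\<i> + \<i>\<^sup>2) ^ 4 = -4"
    by (simp add: power4_eq_xxxx complex_eq_iff)
  then have "(\<i> + \<i>\<^sup>2) ^ 8 = 16"
    using power_mult[of "\<i> + \<i>\<^sup>2" 4 2] by simp
  then have p8: "(\<i> + \<i>\<^sup>2) ^ (8 * k) = of_real (16 ^ k)"
    by (simp add: power_mult)
  have p5: "(\<i> + \<i>\<^sup>2) ^ 5 = -4 * (\<i> + \<i>\<^sup>2)"
    using p4 power_Suc2[of "\<i> + \<i>\<^sup>2" 4] by simp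
  \<comment> \<open>Both exponents leave one factor \<open>\<i> + \<i>\<^sup>2\<close> beyond a
    multiple of 4. Its product with the initial \<open>\<i>\<close> is \<open>-1 - \<i>\<close>, of
    real part -1, scaled by \<open>16 ^ k\<close> and by \<open>-4 * 16 ^ k\<close>
    respectively.\<close>
  have
    "of_int (d (fib_value (string_power [1,0,0] (8 * k + 1) @ [1]))) = (of_int (- (16 ^ k)) :: real)"
    "of_int (d (fib_value (string_power [1,0,0] (8 * k + 5) @ [1]))) = (of_int (4 * 16 ^ k) :: real)"
    unfolding d_eq_Re_fib_partition_gf fib_partition_gf_100_power power_add p8 p5
    by (simp_all add: algebra_simps)
  then show ?thesis unfolding of_int_eq_iff by blast
qed

end
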